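(* For every $k\in\mathbb N$, $k\ge 1$: $\mathrm C_{\sharp\le k+1}\not\le_{\mathrm W}\mathrm{Sort}_k$.
   Context: A represented space $\mathbf X$ is a set $X$ with a partial surjection $\delta_{\mathbf X}:\subseteq\mathbb N^{\mathbb N}\to X$ (a $p$ with $\delta_{\mathbf X}(p)=x$ is a name of $x$). A realizer of a (partial) multivalued function $f:\subseteq\mathbf X\rightrightarrows\mathbf Y$ is a partial $F:\subseteq\mathbb N^{\mathbb N}\to\mathbb N^{\mathbb N}$ with $\delta_{\mathbf Y}(F(p))\in f(\delta_{\mathbf X}(p))$ for all names $p$ of points of $\mathrm{dom}(f)$; write $F\vdash f$. Weihrauch reducibility: $f\le_{\mathrm W}g$ iff there are computable $H,K:\subseteq\mathbb N^{\mathbb N}\to\mathbb N^{\mathbb N}$ such that $(p\mapsto K\langle p,GH(p)\rangle)\vdash f$ for every $G\vdash g$. $\mathcal A(\mathbf X)$ is the represented space of closed subsets of $\mathbf X$ with negative information: a name of $A$ is a name of the open set $X\setminus A$ (its continuous characteristic function into Sierpiński space). For $\mathbf X=\{0,1\}^{\mathbb N}$ one may equivalently represent $A$ by a binary tree $T$ whose set of infinite paths is $A$. Closed choice $\mathrm C_{\mathbf X}:\subseteq\mathcal A(\mathbf X)\rightrightarrows\mathbf X$ maps a non-empty closed set $A$ to an arbitrary point of $A$. $\mathrm C_{\sharp\le n}$ is the restriction of $\mathrm C_{\{0,1\}^{\mathbb N}}$ to closed sets $A$ with $1\le|A|\le n$. $\mathrm{Sort}_d:\{0,\dots,d-1\}^\omega\to\{0,\dots,d-1\}^\omega$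 is defined by $\mathrm{Sort}_d(p)=0^{c_0}1^{c_1}\cdots(m-1)^{c_{m-1}}m^{\infty}$, where $m$ is the least symbol occurring infinitely often in $p$ and $c_l=|\{n: p(n)=l\}|$ for $l<m$. *)

theory Defs
  imports "HOL-Analysis.Analysis" "HOL-Library.Nat_Bijection"
begin

type_synonym baire = "nat \<Rightarrow> nat"

section \<open>Computable partial functions on Baire space\<close>

text \<open>
  Partial recursive functions relative to an oracle \<open>p\<close>. A partial \<open>F\<close> on Baire space is
  computable iff a single oracle program computes \<open>n \<mapsto> F p n\<close> from oracle \<open>p\<close>, for all \<open>p\<close>
  in the domain of \<open>F\<close>.
\<close>

datatype orec =
    Zero
  | Succ
  | Proj nat
  | Oracle
  | Comp orec "orec list"
  | PrimRec orec orec
  | Mu orec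

inductive orec_eval :: "baire \<Rightarrow> orec \<Rightarrow> nat list \<Rightarrow> nat \<Rightarrow> bool" for p :: baire where
  "orec_eval p Zero xs 0"
| "orec_eval p Succ [x] (Suc x)"
| "i < length xs \<Longrightarrow> orec_eval p (Proj i) xs (xs ! i)"
| "orec_eval p Oracle [x] (p x)"
| "list_all2 (\<lambda>g y. orec_eval p g xs y) gs ys \<Longrightarrow> orec_eval p f ys z
     \<Longrightarrow> orec_eval p (Comp f gs) xs z"
| "orec_eval p f xs y \<Longrightarrow> orec_eval p (PrimRec f g) (0 # xs) y"
| "orec_eval p (PrimRec f g) (n # xs) r \<Longrightarrow> orec_eval p g (n # r # xs) y
     \<Longrightarrow> orec_eval p (PrimRec f g) (Suc n # xs) y"
| "orec_eval p f (n # xs) 0 \<Longrightarrow> (\<forall>m<n. \<exists>y. orec_eval p f (m # xs) (Suc y))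
     \<Longrightarrow> orec_eval p (Mu f) xs n"

text \<open>
  As usual in the theory of Weihrauch degrees, the program is unconstrained outside the domain
  of \<open>F\<close>; so restrictions of computable functions are computable.
\<close>

definition computable :: "(baire \<rightharpoonup> baire) \<Rightarrow> bool" where
  "computable F \<longleftrightarrow> (\<exists>e. \<forall>p q. F p = Some q \<longrightarrow> (\<forall>n. orec_eval p e [n] (q n)))"

definition pair :: "baire \<Rightarrow> baire \<Rightarrow> baire" where
  "pair p q n = (if even n then p (n div 2) else q (n div 2))"

section \<open>Represented spaces and Weihrauch reducibility\<close>

text \<open>
  A represented space is given by its representation, a partial map \<open>\<delta>\<close> from Baire space; the
  underlying set is \<open>ran \<delta>\<close>, so that \<open>\<delta>\<close> is automatically a partial surjection onto it.
\<close>

type_synonym 'a rep_space = "baire \<rightharpoonup> 'a"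

text \<open>
  A partial multivalued function \<open>f\<close> between represented spaces; its domain consists of the
  points \<open>x\<close> with \<open>f x \<noteq> {}\<close>.
\<close>

record ('a, 'b) problem =
  source :: "'a rep_space"
  target :: "'b rep_space"
  solutions :: "'a \<Rightarrow> 'b set"

definition realizer :: "(baire \<rightharpoonup> baire) \<Rightarrow> ('a, 'b) problem \<Rightarrow> bool" where
  "realizer F f \<longleftrightarrow>
     (\<forall>p x. source f p = Some x \<and> solutions f x \<noteq> {} \<longrightarrow>
        (\<exists>q y. F p = Some q \<and> target f q = Some y \<and> y \<in> solutions f x))"

definition weihrauch_le :: "('a, 'b) problem \<Rightarrow> ('c, 'd) problem \<Rightarrow> bool"
    (infix "\<le>\<^sub>W" 50) where
  "f \<le>\<^sub>W g \<longleftrightarrow>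
     (\<exists>H K. computable H \<and> computable K \<and>
        (\<forall>G. realizer G g \<longrightarrow>
           realizer
             (\<lambda>p. Option.bind (H p) (\<lambda>q. Option.bind (G q) (\<lambda>r. K (pair p r)))) f))"

section \<open>Choice on Cantor space\<close>

text \<open>Cantor space is \<open>seq_space 2\<close>.\<close>

definition seqs :: "nat \<Rightarrow> (nat \<Rightarrow> nat) set" where
  "seqs d = {x. \<forall>n. x n < d}"

definition seq_space :: "nat \<Rightarrow> (nat \<Rightarrow> nat) rep_space" where
  "seq_space d = (\<lambda>p. if p \<in> seqs d then Some p else None)"

definition binary_tree :: "nat list set \<Rightarrow> bool" where
  "binary_tree T \<longleftrightarrow> T \<subseteq> lists {0, 1} \<and> (\<forall>u v. u @ v \<in> T \<longrightarrow> u \<in> T)"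

definition paths :: "nat list set \<Rightarrow> (nat \<Rightarrow> nat) set" where
  "paths T = {x \<in> seqs 2. \<forall>n. map x [0..<n] \<in> T}"

text \<open>
  Closed subsets of Cantor space with negative information: \<open>p\<close> is a name of \<open>A\<close> iff \<open>p\<close> is the
  characteristic function of some binary tree, not necessarily pruned, whose set of infinite
  paths is \<open>A\<close>.
\<close>

definition named_tree :: "baire \<Rightarrow> nat list set" where
  "named_tree p = {w. p (list_encode w) = 1}"

definition closed_space :: "(nat \<Rightarrow> nat) set rep_space" where
  "closed_space p =
     (if p \<in> seqs 2 \<and> binary_tree (named_tree p) then Some (paths (named_tree p)) else None)"

lemma open_prefix: "open {x :: nat \<Rightarrow> nat. map x [0..<n] = w}"
proof (cases "length w = n")
  case True
  have eq: "{x :: nat \<Rightarrow> nat. map x [0..<n] = w} = (\<Inter>i\<in>{..<n}. (\<lambda>x. x i) -` {w ! i})"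
    using True by (auto simp: list_eq_iff_nth_eq)
  have "open ((\<lambda>x :: nat \<Rightarrow> nat. x i) -` {w ! i})" for i
    by (rule open_vimage) (auto intro: open_discrete continuous_on_product_coordinates)
  then show ?thesis
    unfolding eq by (intro open_INT) auto
next
  case False
  then have "{x :: nat \<Rightarrow> nat. map x [0..<n] = w} = {}"
    by auto
  then show ?thesis by simp
qed

lemma closed_prefix: "closed {x :: nat \<Rightarrow> nat. map x [0..<n] \<in> W}"
proof -
  have "- {x :: nat \<Rightarrow> nat. map x [0..<n] \<in> W} = (\<Union>w\<in>-W. {x. map x [0..<n] = w})"
    by auto
  then show ?thesis
    by (simp only: closed_def) (auto intro: open_prefix)
qed

lemma closed_paths: "closed (paths T)"
proof -
  have "paths T = (\<Inter>n. {x. map x [0..<n] \<in> lists {..<2}}) \<inter> (\<Inter>n. {x. map x [0..<n] \<in> T})"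
  proof -
    have "(\<forall>n. x n < 2) \<longleftrightarrow> (\<forall>n. map x [0..<n] \<in> lists {..<2})" for x :: "nat \<Rightarrow> nat"
      by (auto simp: in_lists_conv_set) (meson atLeastLessThan_iff lessI zero_le)
    then show ?thesis by (auto simp: paths_def seqs_def)
  qed
  then show ?thesis
    by (simp only:) (intro closed_Int closed_INT ballI closed_prefix)
qed

lemma closed_prefix_limit:
  fixes A :: "(nat \<Rightarrow> nat) set"
  assumes "closed A" and lim: "\<And>n. \<exists>y\<in>A. map y [0..<n] = map x [0..<n]"
  shows "x \<in> A"
proof (rule ccontr)
  assume "x \<notin> A"
  moreover have "openin (product_topology (\<lambda>i. euclidean) UNIV) (- A)"
    using assms(1) by (simp add: closed_def open_fun_def)
  ultimately obtain X where X: "x \<in> (\<Pi>\<^sub>E i\<in>UNIV. X i)" "finite {i. X i \<noteq> topspace euclidean}"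
      "(\<Pi>\<^sub>E i\<in>UNIV. X i) \<subseteq> - A"
    using product_topology_open_contains_basis[of "\<lambda>i. euclidean" UNIV "- A" x] by auto
  obtain N where N: "\<And>i. X i \<noteq> UNIV \<Longrightarrow> i < N"
    using X(2) finite_nat_set_iff_bounded by auto
  obtain y where y: "y \<in> A" "map y [0..<N] = map x [0..<N]"
    using lim by blast
  have "y i \<in> X i" for i
    using N[of i] y(2) X(1) by (cases "i < N") (auto simp: PiE_iff)
  then show False using X(3) y(1) by auto
qed

text \<open>The points of the space are exactly the closed subsets of Cantor space.\<close>

lemma ran_closed_space: "ran closed_space = {A. A \<subseteq> seqs 2 \<and> closed A}"
proof (intro equalityI subsetI)
  fix A assume "A \<in> ran closed_space"
  then show "A \<in> {A. A \<subseteq> seqs 2 \<and> closed A}"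
    by (auto simp: ran_def closed_space_def closed_paths split: if_splits) (auto simp: paths_def)
next
  fix A :: "(nat \<Rightarrow> nat) set" assume "A \<in> {A. A \<subseteq> seqs 2 \<and> closed A}"
  then have A: "A \<subseteq> seqs 2" "closed A" by auto
  define T where "T = {map x [0..<n] | x n. x \<in> A}"
  define p where "p = (\<lambda>n. if list_decode n \<in> T then 1 else 0 :: nat)"
  have nt: "named_tree p = T" by (auto simp: named_tree_def p_def)
  have "map x [0..<n] \<in> lists {0, 1}" if "x \<in> A" for x n
  proof -
    have "x i < 2" for i
      using that A(1) by (auto simp: seqs_def)
    then have "x i \<in> {0, 1}" for i
      by (metis insert_iff less_2_cases One_nat_def)
    then show ?thesis
      unfolding in_lists_conv_set set_map by (metis imageE)
  qed
  then have "T \<subseteq> lists {0, 1}"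
    unfolding T_def by blast
  moreover have "u \<in> T" if "u @ v \<in> T" for u v
  proof -
    obtain x n where x: "x \<in> A" "u @ v = map x [0..<n]" using \<open>u @ v \<in> T\<close> by (auto simp: T_def)
    then have "u = take (length u) (map x [0..<n])" by (metis append_eq_conv_conj)
    also have "\<dots> = map x [0..<min (length u) n]" by (simp add: take_map take_upt min_def)
    finally show ?thesis using x(1) by (auto simp: T_def)
  qed
  ultimately have "binary_tree T" by (auto simp: binary_tree_def)
  moreover have "paths T = A"
  proof (intro equalityI subsetI)
    fix x assume "x \<in> paths T"
    then have "map x [0..<n] \<in> T" for n by (auto simp: paths_def)
    then have "\<exists>y\<in>A. map y [0..<n] = map x [0..<n]" for n
      unfolding T_def by (smt (verit) length_map length_upt mem_Collect_eq minus_nat.diff_0)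
    then show "x \<in> A" using closed_prefix_limit A(2) by blast
  qed (use A(1) in \<open>auto simp: paths_def T_def\<close>)
  moreover have "p \<in> seqs 2" by (auto simp: p_def seqs_def)
  ultimately have "closed_space p = Some A" by (simp add: closed_space_def nt)
  then show "A \<in> ran closed_space" by (auto simp: ran_def)
qed

definition closed_choice :: "((nat \<Rightarrow> nat) set, nat \<Rightarrow> nat) problem" where
  "closed_choice =
     \<lparr>source = closed_space, target = seq_space 2,
      solutions = (\<lambda>A. if A \<in> ran closed_space then A else {})\<rparr>"

definition restrict_problem :: "('a, 'b) problem \<Rightarrow> 'a set \<Rightarrow> ('a, 'b) problem" where
  "restrict_problem f D = f\<lparr>solutions := (\<lambda>x. if x \<in> D then solutions f x else {})\<rparr>"

definition choice_card_le :: "nat \<Rightarrow> ((nat \<Rightarrow> nat) set, nat \<Rightarrow> nat) problem" where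
  "choice_card_le n = restrict_problem closed_choice {A. finite A \<and> 1 \<le> card A \<and> card A \<le> n}"

section \<open>Sorting\<close>

definition sort_seq :: "(nat \<Rightarrow> nat) \<Rightarrow> (nat \<Rightarrow> nat)" where
  "sort_seq p =
     (let m = (LEAST l. infinite {n. p n = l});
          w = concat (map (\<lambda>l. replicate (card {n. p n = l}) l) [0..<m])
      in (\<lambda>n. if n < length w then w ! n else m))"

definition Sort :: "nat \<Rightarrow> (nat \<Rightarrow> nat, nat \<Rightarrow> nat) problem" where
  "Sort d =
     \<lparr>source = seq_space d, target = seq_space d,
      solutions = (\<lambda>p. if p \<in> seqs d then {sort_seq p} else {})\<rparr>"

end

theory Submission imports Defs begin

text \<open>
  Only the continuity of the two reductions matters. Consider finite trees with live nodes at depth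
  \<open>D\<close> and call such a stage \<open>settled\<close> for \<open>l\<close> if, as long as every live node keeps a path, the
  instance of \<open>Sort\<^sub>k\<close> contains no further symbols below \<open>l\<close>. A stage with \<open>l + 1\<close> live nodes
  settled for \<open>l\<close> can be refined to a stage with \<open>l + 2\<close> live nodes settled for \<open>l + 1\<close>:
  otherwise the symbol \<open>l\<close> can be forced again and again, and in the limit there is a tree
  with one path for each live node for which \<open>l\<close> occurs infinitely often. There the sorted
  sequence ends in \<open>l\<close> repeated forever, so the solution commits to a live node \<open>u\<close> while the
  sorted sequence seen so far stays correct whatever happens next. Now split \<open>u\<close> and force \<open>l\<close>
  infinitely often again; the solution commits to one of the two halves of \<open>u\<close>, and this half
  can be killed without killing \<open>u\<close>. Starting from the root, one reaches \<open>k + 1\<close> live nodes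
  settled for \<open>k\<close>, which is absurd since all symbols are below \<open>k\<close>.
\<close>

section \<open>Continuity of oracle computations\<close>

text \<open>Identifies the actual value on a nearby oracle with the one that
  \<open>orec_eval_use\<close> derives. For \<open>Mu\<close>, neither of two results can be
  smaller, because the search passes only positive values.\<close>

lemma orec_eval_det: "orec_eval p e xs y \<Longrightarrow> orec_eval p e xs z \<Longrightarrow> y = z"
proof (induction arbitrary: z rule: orec_eval.induct)
  case (5 xs gs ys f y)
  from 5(4) obtain ys' where ys': "list_all2 (\<lambda>g. orec_eval p g xs) gs ys'" "orec_eval p f ys' z"
    by (cases rule: orec_eval.cases) auto
  have "ys = ys'"
    using 5(1) ys'(1) by (auto simp: list_all2_conv_all_nth intro!: nth_equalityI)
  with 5(2) ys'(2) show ?case by blast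
next
  case (7 f g n xs r y)
  from 7(5) obtain r' where "orec_eval p (PrimRec f g) (n # xs) r'" "orec_eval p g (n # r' # xs) z"
    by (cases rule: orec_eval.cases) auto
  with 7 show ?case by blast
next
  case (8 f n xs)
  from "8.prems" have z: "orec_eval p f (z # xs) 0" "\<forall>m<z. \<exists>y. orec_eval p f (m # xs) (Suc y)"
    by (cases rule: orec_eval.cases; simp)+
  have "\<not> z < n" using 8(1,2,3) z(1) by fastforce
  moreover have "\<not> n < z" using 8(1,2,3) z(2) by fastforce
  ultimately show ?case by simp
qed (erule orec_eval.cases; fastforce)+

text \<open>Finitely many thresholds have a maximum. This serves, for instance, the argument lists
  of \<open>Comp\<close>, the search of \<open>Mu\<close> and the first \<open>n\<close> values of
  an output.\<close>

lemma uniform_bound: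
  fixes P :: "nat \<Rightarrow> nat \<Rightarrow> bool"
  assumes "\<And>i N N'. P i N \<Longrightarrow> N \<le> N' \<Longrightarrow> P i N'" and "\<And>i. i < n \<Longrightarrow> \<exists>N. P i N"
  shows "\<exists>N. \<forall>i<n. P i N"
  using assms(2)
proof (induction n)
  case (Suc n)
  then obtain N M where "\<forall>i<n. P i N" "P n M" by (meson less_Suc_eq)
  then have "\<forall>i<Suc n. P i (max N M)"
    using assms(1) by (metis less_Suc_eq max.cobounded1 max.cobounded2)
  then show ?case by blast
qed simp

text \<open>A halting computation queries the oracle only finitely often, so it runs alike on every
  oracle that agrees beyond its largest query.\<close>

lemma orec_eval_use:
  "orec_eval p e xs y \<Longrightarrow> \<exists>N. \<forall>p'. (\<forall>i<N. p' i = p i) \<longrightarrow> orec_eval p' e xs y"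
proof (induction rule: orec_eval.induct)
  case (4 x)
  have "\<forall>p'. (\<forall>i<Suc x. p' i = p i) \<longrightarrow> orec_eval p' Oracle [x] (p x)"
    by (metis lessI orec_eval.intros(4))
  then show ?case by blast
next
  case (5 xs gs ys f z)
  have "\<exists>N. \<forall>i<length gs. \<forall>p'. (\<forall>j<N. p' j = p j) \<longrightarrow> orec_eval p' (gs ! i) xs (ys ! i)"
    by (rule uniform_bound) (use 5(1) in \<open>auto simp: list_all2_conv_all_nth\<close>)
  then obtain N where "\<forall>i<length gs. \<forall>p'. (\<forall>j<N. p' j = p j) \<longrightarrow> orec_eval p' (gs ! i) xs (ys ! i)" ..
  moreover obtain M where "\<forall>p'. (\<forall>i<M. p' i = p i) \<longrightarrow> orec_eval p' f ys z" using 5 by blast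
  moreover have "length gs = length ys" using 5(1) by (rule list_all2_lengthD)
  ultimately have "\<forall>p'. (\<forall>i<max N M. p' i = p i) \<longrightarrow> orec_eval p' (Comp f gs) xs z"
    by (auto intro!: orec_eval.intros(5) list_all2_all_nthI)
  then show ?case by blast
next
  case (6 f xs y g)
  then show ?case by (meson orec_eval.intros(6))
next
  case (7 f g n xs r y)
  then obtain N M where
    "\<forall>p'. (\<forall>i<N. p' i = p i) \<longrightarrow> orec_eval p' (PrimRec f g) (n # xs) r"
    "\<forall>p'. (\<forall>i<M. p' i = p i) \<longrightarrow> orec_eval p' g (n # r # xs) y" by blast
  then have "\<forall>p'. (\<forall>i<max N M. p' i = p i) \<longrightarrow> orec_eval p' (PrimRec f g) (Suc n # xs) y"
    by (intro allI impI orec_eval.intros(7)[where n = n and r = r]) simp_all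
  then show ?case by blast
next
  case (8 f n xs)
  have "\<exists>N. \<forall>m<n. \<forall>p'. (\<forall>j<N. p' j = p j) \<longrightarrow> (\<exists>y. orec_eval p' f (m # xs) (Suc y))"
  proof (rule uniform_bound)
    fix m assume "m < n"
    then obtain y N where "\<forall>p'. (\<forall>j<N. p' j = p j) \<longrightarrow> orec_eval p' f (m # xs) (Suc y)"
      using 8 by meson
    then show "\<exists>N. \<forall>p'. (\<forall>j<N. p' j = p j) \<longrightarrow> (\<exists>y. orec_eval p' f (m # xs) (Suc y))"
      by blast
  qed auto
  then obtain N where
    "\<forall>m<n. \<forall>p'. (\<forall>j<N. p' j = p j) \<longrightarrow> (\<exists>y. orec_eval p' f (m # xs) (Suc y))" ..
  moreover obtain M where "\<forall>p'. (\<forall>i<M. p' i = p i) \<longrightarrow> orec_eval p' f (n # xs) 0" using 8 by meson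
  ultimately have "\<forall>p'. (\<forall>i<max N M. p' i = p i) \<longrightarrow> orec_eval p' (Mu f) xs n"
    by (intro allI impI orec_eval.intros(8)) simp_all
  then show ?case by blast
qed (auto intro: orec_eval.intros)

text \<open>One program serves the whole domain of \<open>F\<close>, so the oracle use of the first
  \<open>n\<close> outputs at \<open>p\<close> is a modulus of continuity there.\<close>

lemma computable_continuous:
  assumes "computable F" and "F p = Some q"
  shows "\<exists>N. \<forall>p' q'. F p' = Some q' \<and> (\<forall>i<N. p' i = p i) \<longrightarrow> (\<forall>i<n. q' i = q i)"
proof -
  obtain e where e: "\<And>p q n. F p = Some q \<Longrightarrow> orec_eval p e [n] (q n)"
    using assms(1) by (auto simp: computable_def)
  have "\<exists>N. \<forall>i<n. \<forall>p'. (\<forall>j<N. p' j = p j) \<longrightarrow> orec_eval p' e [i] (q i)"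
  proof (rule uniform_bound)
    fix i
    show "\<exists>N. \<forall>p'. (\<forall>j<N. p' j = p j) \<longrightarrow> orec_eval p' e [i] (q i)"
      by (rule orec_eval_use) (rule e[OF assms(2)])
  qed auto
  then show ?thesis using e orec_eval_det by meson
qed

section \<open>Sorting\<close>

lemma infinite_symbol:
  assumes "q \<in> seqs d"
  obtains l where "l < d" "infinite {n. q n = l}"
proof -
  have "q ` UNIV \<subseteq> {..<d}" using assms by (auto simp: seqs_def)
  then have "finite (q ` UNIV)" by (rule finite_subset) simp
  then obtain a where "infinite {n \<in> UNIV. q n = q a}"
    using pigeonhole_infinite[of UNIV q] by auto
  then show thesis using that[of "q a"] assms by (simp add: seqs_def)
qed

lemma sort_seq_in_seqs:
  assumes "q \<in> seqs d"
  shows "sort_seq q \<in> seqs d"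
proof -
  define m where "m = (LEAST l. infinite {n. q n = l})"
  define w where "w = concat (map (\<lambda>l. replicate (card {n. q n = l}) l) [0..<m])"
  obtain l where "l < d" "infinite {n. q n = l}" using infinite_symbol[OF assms] .
  then have "m < d" unfolding m_def by (meson Least_le le_less_trans)
  moreover have "\<forall>a \<in> set w. a < m" by (auto simp: w_def)
  then have "w ! n < m" if "n < length w" for n using that by simp
  ultimately show ?thesis
    unfolding sort_seq_def Let_def m_def[symmetric] w_def[symmetric] seqs_def
    by (auto intro: less_trans)
qed

text \<open>All symbols below \<open>j\<close> occur before \<open>N\<close> and form the same
  initial blocks for both sequences. Then \<open>sort_seq q\<close> is constantly \<open>j\<close>,
  while \<open>sort_seq q'\<close> continues with at least \<open>M\<close> copies of
  \<open>j\<close>.\<close>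

lemma sort_seq_agree:
  assumes agree: "\<And>i. i < N \<Longrightarrow> q i = q' i"
    and late: "\<And>i. i \<ge> N \<Longrightarrow> j \<le> q i" "\<And>i. i \<ge> N \<Longrightarrow> j \<le> q' i"
    and inf: "infinite {i. q i = j}"
    and M: "M \<le> card {i. i < N \<and> q i = j}"
    and q': "q' \<in> seqs d"
    and n: "n < M"
  shows "sort_seq q n = sort_seq q' n"
proof -
  let ?blocks = "\<lambda>q. map (\<lambda>l. replicate (card {n :: nat. q n = l}) l)"
  define w where "w = concat (?blocks q [0..<j])"
  have early: "{i. q i = l} = {i. i < N \<and> q i = l}" "{i. q' i = l} = {i. i < N \<and> q i = l}"
    if "l < j" for l
    using that late agree by (metis leD not_le_imp_less)+
  have fin: "finite {i. q i = l}" "finite {i. q' i = l}" if "l < j" for l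
    using early[OF that] by simp_all
  have w': "w = concat (?blocks q' [0..<j])"
    unfolding w_def by (intro arg_cong[of _ _ concat] map_cong refl) (simp add: early)
  have "(LEAST l. infinite {n. q n = l}) = j"
    using inf fin by (intro Least_equality) (auto simp: not_less[symmetric])
  then have q_eq: "sort_seq q n = (if n < length w then w ! n else j)"
    by (simp add: sort_seq_def w_def Let_def)
  define m where "m = (LEAST l. infinite {n. q' n = l})"
  obtain l where "infinite {n. q' n = l}" using infinite_symbol[OF q'] .
  then have "infinite {n. q' n = m}" unfolding m_def by (rule LeastI)
  then have "j \<le> m" using fin(2) by (meson not_le_imp_less)
  have q'_eq: "sort_seq q' n =
      (if n < length (concat (?blocks q' [0..<m])) then concat (?blocks q' [0..<m]) ! n else m)"
    by (simp add: sort_seq_def m_def Let_def)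
  show ?thesis
  proof (cases "m = j")
    case True
    then show ?thesis using q_eq q'_eq w' by simp
  next
    case False
    then have "j < m" using \<open>j \<le> m\<close> by simp
    then have "[0..<m] = [0..<j] @ j # [Suc j..<m]"
      using upt_add_eq_append[of 0 j "m - j"] by (simp add: upt_conv_Cons)
    \<comment> \<open>Without finiteness the next bound would fail, since \<open>card\<close> of an
      infinite set is 0.\<close>
    moreover have "finite {i. q' i = j}"
      using not_less_Least[OF \<open>j < m\<close>[unfolded m_def]] by simp
    then have "card {i. i < N \<and> q i = j} \<le> card {i. q' i = j}"
      using agree by (intro card_mono) auto
    then have "n < card {i. q' i = j}" using M n by simp
    ultimately show ?thesis unfolding q_eq q'_eq by (auto simp: w' nth_append)
  qed
qed

section \<open>Finite stages of a tree\<close>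

definition pre :: "nat \<Rightarrow> (nat \<Rightarrow> nat) \<Rightarrow> nat list" where
  "pre n x = map x [0..<n]"

definition level :: "nat list set \<Rightarrow> nat \<Rightarrow> nat list set" where
  "level F D = {w \<in> F. length w = D}"

definition agree :: "nat \<Rightarrow> nat list set \<Rightarrow> nat list set \<Rightarrow> bool" where
  "agree D F F' \<longleftrightarrow> (\<forall>w. length w \<le> D \<longrightarrow> (w \<in> F \<longleftrightarrow> w \<in> F'))"

text \<open>These are exactly the trees that represent instances in the domain of
  \<open>choice_card_le c\<close>.\<close>

definition valid :: "nat \<Rightarrow> nat list set \<Rightarrow> bool" where
  "valid c T \<longleftrightarrow> binary_tree T \<and> finite (paths T) \<and> 1 \<le> card (paths T) \<and> card (paths T) \<le> c"

text \<open>A pair of \<open>F\<close> and \<open>D\<close> stands for the part of \<open>F\<close> up to depth \<open>D\<close>; its live nodes are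
  \<open>level F D\<close>.\<close>

definition refines :: "nat list set \<Rightarrow> nat \<Rightarrow> nat list set \<Rightarrow> nat \<Rightarrow> bool" where
  "refines F D F' D' \<longleftrightarrow> D \<le> D' \<and> agree D F F' \<and> level F D \<subseteq> take D ` level F' D'"

text \<open>The completions of a stage to an instance that leave no live node without a path.
  Several paths may share a live node; the converse inclusion is automatic by
  \<open>ext_level\<close>.\<close>

definition ext :: "nat \<Rightarrow> nat list set \<Rightarrow> nat \<Rightarrow> nat list set \<Rightarrow> bool" where
  "ext c F D T \<longleftrightarrow> valid c T \<and> agree D F T \<and> level F D \<subseteq> pre D ` paths T"

text \<open>In all uses, \<open>V\<close> consists of children of nodes of \<open>F\<close> at depth
  \<open>D\<close> and becomes the last level of the new tree.\<close>

definition graft :: "nat list set \<Rightarrow> nat \<Rightarrow> nat list set \<Rightarrow> nat list set" where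
  "graft F D V = {w \<in> F. length w \<le> D} \<union> V"

section \<open>Prefixes, levels and refinement of stages\<close>

lemma length_pre [simp]: "length (pre n x) = n"
  by (simp add: pre_def)

lemma nth_pre [simp]: "i < n \<Longrightarrow> pre n x ! i = x i"
  by (simp add: pre_def)

lemma pre_Suc: "pre (Suc n) x = pre n x @ [x n]"
  by (simp add: pre_def)

lemma take_pre [simp]: "m \<le> n \<Longrightarrow> take m (pre n x) = pre m x"
  by (simp add: pre_def take_map)

lemma pre_eq_mono: "pre n x = pre n y \<Longrightarrow> m \<le> n \<Longrightarrow> pre m x = pre m y"
  by (metis take_pre)

lemma pre_eq_iff: "pre n x = pre n y \<longleftrightarrow> (\<forall>i<n. x i = y i)"
  by (auto simp: pre_def)

lemma mem_paths: "x \<in> paths T \<longleftrightarrow> x \<in> seqs 2 \<and> (\<forall>n. pre n x \<in> T)"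
  by (simp add: paths_def pre_def)

lemma pre_level: "x \<in> paths T \<Longrightarrow> pre n x \<in> level T n"
  by (simp add: mem_paths level_def)

lemma tree_take: "binary_tree T \<Longrightarrow> w \<in> T \<Longrightarrow> take n w \<in> T"
  unfolding binary_tree_def by (metis append_take_drop_id)

lemma finite_level:
  assumes "binary_tree F"
  shows "finite (level F D)"
proof (rule finite_subset)
  show "level F D \<subseteq> {w. set w \<subseteq> {0, 1} \<and> length w = D}"
    using assms by (auto simp: level_def binary_tree_def)
  show "finite {w. set w \<subseteq> {0, 1 :: nat} \<and> length w = D}"
    by (rule finite_lists_length_eq) simp
qed

lemma agree_trans: "agree D F F' \<Longrightarrow> agree D' F' F'' \<Longrightarrow> D \<le> D' \<Longrightarrow> agree D F F''"
  by (auto simp: agree_def)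

lemma agree_mono: "agree D F F' \<Longrightarrow> m \<le> D \<Longrightarrow> agree m F F'"
  by (auto simp: agree_def)

lemma agree_level: "agree D F F' \<Longrightarrow> m \<le> D \<Longrightarrow> level F m = level F' m"
  by (auto simp: agree_def level_def)

lemma refines_refl: "refines F D F D"
  by (force simp: refines_def agree_def level_def)

lemma refines_trans:
  assumes "refines F D F' D'" "refines F' D' F'' D''"
  shows "refines F D F'' D''"
proof -
  have "level F D \<subseteq> take D ` level F' D'" "level F' D' \<subseteq> take D' ` level F'' D''"
    using assms by (auto simp: refines_def)
  then have "level F D \<subseteq> take D ` take D' ` level F'' D''" by (meson image_mono order_trans)
  also have "\<dots> = take D ` level F'' D''"
    using assms by (simp add: refines_def image_image min_absorb1)
  finally show ?thesis
    using assms by (auto simp: refines_def intro: agree_trans)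
qed

lemma refines_level:
  assumes "refines F D F' D'" "binary_tree F'"
  shows "take D ` level F' D' = level F D"
proof
  show "take D ` level F' D' \<subseteq> level F D"
    using assms tree_take[OF assms(2)] by (auto simp: refines_def level_def agree_def)
qed (use assms in \<open>simp add: refines_def\<close>)

text \<open>Each live node of the coarser stage is a prefix of a live node of the finer one and
  inherits its path. Hence refining a stage can only shrink its set of completions.\<close>

lemma ext_refines:
  assumes "refines F D F' D'" "ext c F' D' T"
  shows "ext c F D T"
proof -
  have "level F D \<subseteq> take D ` level F' D'" "level F' D' \<subseteq> pre D' ` paths T"
    using assms by (auto simp: refines_def ext_def)
  then have "level F D \<subseteq> take D ` pre D' ` paths T" by (meson image_mono order_trans)
  also have "\<dots> = pre D ` paths T"
    using assms by (simp add: refines_def image_image)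
  finally show ?thesis
    using assms by (auto simp: refines_def ext_def intro: agree_trans)
qed

lemma ext_level: "ext c F D T \<Longrightarrow> pre D ` paths T = level F D"
  unfolding ext_def by (metis agree_level image_subset_iff order_refl pre_level subset_antisym)

section \<open>Adding one level to a stage\<close>

lemma agree_graft: "\<forall>w\<in>V. length w = Suc D \<Longrightarrow> agree D F (graft F D V)"
  by (auto simp: agree_def graft_def)

lemma level_graft: "\<forall>w\<in>V. length w = Suc D \<Longrightarrow> level (graft F D V) (Suc D) = V"
  by (auto simp: level_def graft_def)

lemma binary_tree_graft:
  assumes F: "binary_tree F"
    and V: "\<forall>w\<in>V. length w = Suc D \<and> w \<in> lists {0, 1} \<and> take D w \<in> F"
  shows "binary_tree (graft F D V)"
  unfolding binary_tree_def
proof (intro conjI allI impI)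
  show "graft F D V \<subseteq> lists {0, 1}"
    using assms by (auto simp: graft_def binary_tree_def)
  fix u v assume uv: "u @ v \<in> graft F D V"
  show "u \<in> graft F D V"
  proof (cases "u @ v \<in> V \<and> v \<noteq> []")
    case True
    then have len: "length u \<le> D" using V by (cases v) auto
    then have "u = take (length u) (take D (u @ v))" by (simp add: min_absorb1)
    then have "u \<in> F" using V True tree_take[OF F] by metis
    then show ?thesis using len by (simp add: graft_def)
  next
    case False
    then show ?thesis using uv F by (auto simp: graft_def binary_tree_def)
  qed
qed

section \<open>Completing a stage with one path per live node\<close>

definition fill :: "nat list set \<Rightarrow> nat \<Rightarrow> nat list set" where
  "fill F D = {w \<in> F. length w \<le> D} \<union> {u @ replicate i 0 | u i. u \<in> level F D}"

lemma agree_fill: "agree D F (fill F D)"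
  by (auto simp: agree_def fill_def level_def)

lemma binary_tree_fill:
  assumes F: "binary_tree F"
  shows "binary_tree (fill F D)"
  unfolding binary_tree_def
proof (intro conjI allI impI)
  have "w \<in> lists {0, 1}" if "w \<in> F" for w
    using F that by (auto simp: binary_tree_def simp del: One_nat_def)
  then show "fill F D \<subseteq> lists {0, 1}"
    by (fastforce simp: fill_def level_def)
  fix u v assume "u @ v \<in> fill F D"
  then consider "u @ v \<in> F" "length (u @ v) \<le> D"
    | w i where "w \<in> level F D" "u @ v = w @ replicate i 0"
    by (auto simp: fill_def)
  then show "u \<in> fill F D"
  proof cases
    case 1
    then show ?thesis using F by (auto simp: fill_def binary_tree_def)
  next
    case (2 w i)
    have "u = take (length u) (u @ v)" by simp
    also have "\<dots> = take (length u) w @ replicate (min (length u - D) i) 0"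
      using 2 by (simp add: level_def min.commute)
    finally have u: "u = \<dots>" .
    show ?thesis
    proof (cases "length u \<le> D")
      case True
      then have "u = take (length u) w" using u by simp
      then have "u \<in> F" using 2(1) tree_take[OF F, of w "length u"] by (simp add: level_def)
      then show ?thesis using True by (simp add: fill_def)
    next
      case False
      then have "u = w @ replicate (min (length u - D) i) 0" using u 2(1) by (simp add: level_def)
      then show ?thesis using 2(1) by (auto simp: fill_def)
    qed
  qed
qed

text \<open>Beyond depth \<open>D\<close> a path can only continue a live node by zeros, so its
  first \<open>D\<close> symbols determine it.\<close>

lemma bij_betw_paths_fill:
  assumes F: "binary_tree F"
  shows "bij_betw (pre D) (paths (fill F D)) (level F D)"
  unfolding bij_betw_def
proof
  have zero: "x i = 0" if x: "x \<in> paths (fill F D)" and i: "D \<le> i" for x i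
  proof -
    have "pre (Suc i) x \<in> fill F D" using x by (simp add: mem_paths)
    then obtain u n where "pre (Suc i) x = u @ replicate n 0" "length u = D"
      using i by (auto simp: fill_def level_def)
    moreover from this have "length u + n = Suc i" by (metis length_append length_pre length_replicate)
    ultimately have "pre (Suc i) x ! i = 0" using i by (simp add: nth_append)
    then show ?thesis by simp
  qed
  show "inj_on (pre D) (paths (fill F D))"
  proof (intro inj_onI HOL.ext)
    fix x y i assume "x \<in> paths (fill F D)" "y \<in> paths (fill F D)" "pre D x = pre D y"
    then show "x i = y i" using zero[of x i] zero[of y i]
      by (cases "i < D") (auto simp: pre_eq_iff)
  qed
  show "pre D ` paths (fill F D) = level F D"
  proof (intro equalityI subsetI)
    fix u assume "u \<in> pre D ` paths (fill F D)"
    then show "u \<in> level F D"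
      using pre_level agree_level[OF agree_fill] by blast
  next
    fix u assume u: "u \<in> level F D"
    define x where "x i = (if i < D then u ! i else 0)" for i
    have len: "length u = D" using u by (simp add: level_def)
    have x: "pre n x = take n u @ replicate (n - D) 0" for n
      by (rule nth_equalityI) (auto simp: len x_def nth_append)
    have "u \<in> lists {0, 1}" using u F by (auto simp: level_def binary_tree_def)
    then have "u ! i < 2" if "i < D" for i
    proof -
      have "u ! i \<in> {0, 1}"
        using \<open>u \<in> lists {0, 1}\<close> that len by (meson in_listsD nth_mem)
      then show ?thesis by auto
    qed
    then have "x \<in> seqs 2" by (auto simp: seqs_def x_def)
    moreover have "pre n x \<in> fill F D" for n
    proof (cases "n \<le> D")
      case True
      then show ?thesis
        using u tree_take[OF F, of u n] by (simp add: x fill_def level_def)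
    next
      case False
      then show ?thesis using u len by (auto simp: x fill_def)
    qed
    ultimately have "x \<in> paths (fill F D)" by (simp add: mem_paths)
    moreover have "pre D x = u" using len by (simp add: x)
    ultimately show "u \<in> pre D ` paths (fill F D)" by blast
  qed
qed

lemma ext_bij:
  assumes "binary_tree T" "agree D F T" "bij_betw (pre D) (paths T) (level F D)"
    and "finite (level F D)" "1 \<le> card (level F D)" "card (level F D) \<le> c"
  shows "ext c F D T"
  using assms bij_betw_same_card[OF assms(3)] bij_betw_finite[OF assms(3)]
  by (simp add: ext_def valid_def bij_betw_def)

lemma ext_fill:
  assumes "binary_tree F" "1 \<le> card (level F D)" "card (level F D) \<le> c"
  shows "ext c F D (fill F D)"
  using assms
  by (intro ext_bij binary_tree_fill agree_fill bij_betw_paths_fill finite_level)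

text \<open>Refinement maps each level onto the earlier ones. As the number of live nodes stays
  \<open>c\<close>, these maps are bijections, so each live node has a unique coherent chain of
  later live nodes, which is its path.\<close>

lemma limit_tree:
  fixes F :: "nat \<Rightarrow> nat list set" and D :: "nat \<Rightarrow> nat"
  assumes F: "\<And>i. binary_tree (F i)"
    and D: "\<And>i. D i < D (Suc i)"
    and ref: "\<And>i. refines (F i) (D i) (F (Suc i)) (D (Suc i))"
    and card: "\<And>i. card (level (F i) (D i)) = c"
  obtains T where "binary_tree T" "\<And>i. agree (D i) (F i) T"
    "\<And>i. bij_betw (pre (D i)) (paths T) (level (F i) (D i))"
proof
  \<comment> \<open>Since \<open>D n\<close> is at least \<open>n\<close>, the status of a word of
    length \<open>n\<close> is final from stage \<open>n\<close> on.\<close>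
  define T where "T = {w. w \<in> F (length w)}"
  have refs: "refines (F i) (D i) (F j) (D j)" if "i \<le> j" for i j
    using that by (induction j rule: dec_induct) (auto intro: refines_refl refines_trans ref)
  have i_le: "i \<le> D i" for i
    using D by (intro strict_mono_imp_increasing) (simp add: strict_mono_Suc_iff)
  show ag: "agree (D i) (F i) T" for i
    unfolding agree_def
  proof (intro allI impI)
    fix w :: "nat list" assume w: "length w \<le> D i"
    have "agree (length w) (F i) (F (length w))"
    proof (cases "i \<le> length w")
      case True
      then show ?thesis using refs[of i "length w"] w by (auto simp: refines_def agree_def)
    next
      case False
      then show ?thesis
        using refs[of "length w" i] i_le[of "length w"] by (auto simp: refines_def agree_def)
    qed
    then show "w \<in> F i \<longleftrightarrow> w \<in> T" by (simp add: agree_def T_def)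
  qed
  show "binary_tree T"
    unfolding binary_tree_def
  proof (intro conjI allI impI)
    show "T \<subseteq> lists {0, 1}" using F unfolding T_def binary_tree_def by blast
    fix u v assume uv: "u @ v \<in> T"
    let ?n = "length (u @ v)"
    have "u \<in> F ?n" using uv F[of ?n] unfolding T_def binary_tree_def by blast
    moreover have "length u \<le> D ?n" using i_le[of ?n] by simp
    ultimately show "u \<in> T" using ag[of ?n] by (simp add: agree_def)
  qed
  have path_level: "pre (D i) x \<in> level (F i) (D i)" if "x \<in> paths T" for x i
    using pre_level[OF that] agree_level[OF ag] by blast
  have inj: "inj_on (take (D i)) (level (F j) (D j))" if "i \<le> j" for i j
    by (rule eq_card_imp_inj_on[OF finite_level[OF F]])
      (simp add: refines_level[OF refs[OF that] F] card)
  fix i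
  show "bij_betw (pre (D i)) (paths T) (level (F i) (D i))"
    unfolding bij_betw_def
  proof
    show "inj_on (pre (D i)) (paths T)"
    proof (intro inj_onI HOL.ext)
      fix x y t assume xy: "x \<in> paths T" "y \<in> paths T" "pre (D i) x = pre (D i) y"
      define j where "j = max i (Suc t)"
      have "i \<le> j" "D i \<le> D j" "t < D j"
        using refs[of i j] i_le[of j] by (auto simp: j_def refines_def)
      then have "pre (D j) x = pre (D j) y"
        using inj_onD[OF inj[of i j]] path_level xy by simp
      then show "x t = y t" using \<open>t < D j\<close> by (simp add: pre_eq_iff)
    qed
    show "pre (D i) ` paths T = level (F i) (D i)"
    proof (intro equalityI subsetI)
      fix u assume u: "u \<in> level (F i) (D i)"
      \<comment> \<open>A coherent chain of live nodes, anchored at \<open>u\<close> by the clause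
        for \<open>n = 0\<close>; its limit is the path sought.\<close>
      have "\<exists>f. \<forall>n. (f n \<in> level (F (i + n)) (D (i + n)) \<and> (n = 0 \<longrightarrow> f n = u))
          \<and> take (D (i + n)) (f (Suc n)) = f n"
      proof (rule dependent_nat_choice)
        show "\<exists>v. v \<in> level (F (i + 0)) (D (i + 0)) \<and> (0 = 0 \<longrightarrow> v = u)" using u by auto
        fix v n assume "v \<in> level (F (i + n)) (D (i + n)) \<and> (n = 0 \<longrightarrow> v = u)"
        then have "v \<in> take (D (i + n)) ` level (F (Suc (i + n))) (D (Suc (i + n)))"
          using ref[of "i + n"] by (auto simp: refines_def)
        then show "\<exists>v'. (v' \<in> level (F (i + Suc n)) (D (i + Suc n)) \<and> (Suc n = 0 \<longrightarrow> v' = u))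
            \<and> take (D (i + n)) v' = v" by auto
      qed
      then obtain f where f: "\<And>n. f n \<in> level (F (i + n)) (D (i + n))" "f 0 = u"
        "\<And>n. take (D (i + n)) (f (Suc n)) = f n" by blast
      have len: "length (f n) = D (i + n)" for n using f(1) by (simp add: level_def)
      have Dle: "D (i + m) \<le> D (i + n)" if "m \<le> n" for m n
        using refs[of "i + m" "i + n"] that by (simp add: refines_def)
      have nested: "take (D (i + m)) (f n) = f m" if "m \<le> n" for m n
        using that
      proof (induction n rule: dec_induct)
        case base
        then show ?case by (simp add: len)
      next
        case (step n)
        have "take (D (i + m)) (f (Suc n)) = take (D (i + m)) (take (D (i + n)) (f (Suc n)))"
          using Dle[OF step(1)] by (simp add: min_absorb1)
        then show ?case using f(3) step by simp
      qed
      define x where "x t = f (Suc t) ! t" for t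
      have x: "f n ! t = x t" if "t < D (i + n)" for n t
      proof -
        have t: "t < D (i + Suc t)" using i_le[of "i + Suc t"] by simp
        have "f n ! t = f (max n (Suc t)) ! t"
          using nested[of n "max n (Suc t)"] that by (metis max.cobounded1 nth_take)
        also have "\<dots> = f (Suc t) ! t"
          using nested[of "Suc t" "max n (Suc t)"] t by (metis max.cobounded2 nth_take)
        finally show ?thesis by (simp add: x_def)
      qed
      have pre_x: "pre (D (i + n)) x = f n" for n
        by (rule nth_equalityI) (auto simp: len x)
      have in_F: "pre n x \<in> T \<and> pre n x \<in> lists {0, 1}" for n
      proof -
        have n: "n \<le> D (i + n)" using i_le[of "i + n"] by simp
        have "pre n x = take n (f n)" using n pre_x[of n] by (metis take_pre)
        then have *: "pre n x \<in> F (i + n)"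
          using f(1)[of n] tree_take[OF F[of "i + n"]] by (simp add: level_def)
        then have "pre n x \<in> T" using ag[of "i + n"] n by (simp add: agree_def)
        then show ?thesis using * F[of "i + n"] by (auto simp: binary_tree_def)
      qed
      have "x n < 2" for n
        using in_F[of "Suc n"] by (auto simp: pre_Suc)
      then have "x \<in> paths T" using in_F by (simp add: mem_paths seqs_def)
      then show "u \<in> pre (D i) ` paths T" using pre_x[of 0] f(2) by force
    qed (use path_level in blast)
  qed
qed

section \<open>Selecting the surviving paths and splitting a live node\<close>

lemma inj_on_pre_mono: "inj_on (pre m) X \<Longrightarrow> m \<le> n \<Longrightarrow> inj_on (pre n) X"
  by (rule inj_onI) (erule inj_onD, erule pre_eq_mono)

lemma inj_on_pre_paths:
  assumes "ext c F D T" "card (paths T) = card (level F D)"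
  shows "inj_on (pre D) (paths T)"
proof (rule eq_card_imp_inj_on)
  show "finite (paths T)" using assms(1) by (simp add: ext_def valid_def)
  show "card (pre D ` paths T) = card (paths T)" using assms(2) ext_level[OF assms(1)] by simp
qed

text \<open>Killing the paths outside \<open>X\<close> only at depth \<open>Suc E\<close> is
  invisible to anything that reads the tree up to depth \<open>E\<close>. It refines an earlier
  stage as long as \<open>X\<close> still meets all live nodes of that stage.\<close>

lemma prune:
  fixes E :: nat
  assumes T: "binary_tree T" and X: "X \<subseteq> paths T"
  defines "T' \<equiv> graft T E (pre (Suc E) ` X)"
  shows "binary_tree T'" "agree E T T'" "level T' (Suc E) = pre (Suc E) ` X"
    and "D \<le> E \<Longrightarrow> agree D F T \<Longrightarrow> level F D \<subseteq> pre D ` X \<Longrightarrow> refines F D T' (Suc E)"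
proof -
  have mem: "pre n x \<in> T \<and> pre n x \<in> lists {0, 1}" if "x \<in> X" for x n
  proof -
    have "pre n x \<in> T" using that X by (auto simp: mem_paths)
    moreover have "T \<subseteq> lists {0, 1}" using T by (simp add: binary_tree_def)
    ultimately show ?thesis by blast
  qed
  show "binary_tree T'"
    unfolding T'_def by (rule binary_tree_graft[OF T]) (use mem in force)
  show ag: "agree E T T'" unfolding T'_def by (rule agree_graft) auto
  show lev: "level T' (Suc E) = pre (Suc E) ` X" unfolding T'_def by (rule level_graft) auto
  assume D: "D \<le> E" "agree D F T" "level F D \<subseteq> pre D ` X"
  then show "refines F D T' (Suc E)"
    using agree_trans[OF D(2) ag D(1)] by (simp add: refines_def lev image_image)
qed

text \<open>Every live node passes to its child 0, and \<open>u\<close> also to its child 1.\<close>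

lemma split_node:
  assumes F: "binary_tree F" and u: "u \<in> level F D"
  obtains F' where "binary_tree F'" "refines F D F' (Suc D)"
    "card (level F' (Suc D)) = Suc (card (level F D))"
    "u @ [0] \<in> level F' (Suc D)" "u @ [1] \<in> level F' (Suc D)"
proof
  define V where "V = insert (u @ [1]) ((\<lambda>w. w @ [0]) ` level F D)"
  have "w \<in> lists {0, 1}" if "w \<in> level F D" for w
    using F that by (auto simp: binary_tree_def level_def simp del: One_nat_def)
  then have V: "\<forall>w\<in>V. length w = Suc D \<and> w \<in> lists {0, 1} \<and> take D w \<in> F"
    using u by (auto simp: V_def level_def)
  then have len: "\<forall>w\<in>V. length w = Suc D" by blast
  note lev = level_graft[OF len, of F]
  show "binary_tree (graft F D V)" using binary_tree_graft[OF F V] .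
  have "w \<in> take D ` V" if "w \<in> level F D" for w
    by (rule image_eqI[of _ _ "w @ [0]"]) (use that in \<open>auto simp: V_def level_def\<close>)
  then show "refines F D (graft F D V) (Suc D)"
    using agree_graft[OF len, of F] by (auto simp: refines_def lev)
  have "card V = Suc (card ((\<lambda>w. w @ [0]) ` level F D))"
    unfolding V_def using finite_level[OF F] by (subst card_insert_disjoint) auto
  also have "card ((\<lambda>w. w @ [0]) ` level F D) = card (level F D)"
    by (rule card_image) (simp add: inj_on_def)
  finally show "card (level (graft F D V) (Suc D)) = Suc (card (level F D))" by (simp add: lev)
  show "u @ [0] \<in> level (graft F D V) (Suc D)" "u @ [1] \<in> level (graft F D V) (Suc D)"
    using u unfolding lev by (auto simp: V_def)
qed

section \<open>Forcing symbols\<close>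

text \<open>\<open>h T\<close> is the instance of \<open>Sort\<^sub>k\<close> computed from the tree \<open>T\<close>, and \<open>g T\<close> the path computed
  from \<open>T\<close> and the sorted instance.\<close>

locale sort_reduction =
  fixes k :: nat and h g :: "nat list set \<Rightarrow> nat \<Rightarrow> nat"
  assumes h_seqs: "valid (Suc k) T \<Longrightarrow> h T \<in> seqs k"
    and h_cont: "valid (Suc k) T \<Longrightarrow>
      \<exists>D. \<forall>T'. valid (Suc k) T' \<and> agree D T T' \<longrightarrow> (\<forall>i<n. h T' i = h T i)"
    and g_path: "valid (Suc k) T \<Longrightarrow> g T \<in> paths T"
    and g_cont: "valid (Suc k) T \<Longrightarrow>
      \<exists>D N. \<forall>T'. valid (Suc k) T' \<and> agree D T T' \<and>
        (\<forall>i<N. sort_seq (h T) i = sort_seq (h T') i) \<longrightarrow> pre n (g T') = pre n (g T)"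
begin

text \<open>The bound \<open>N\<close> is uniform over all completions, and these may have up to
  \<open>Suc k\<close> paths however few the live nodes. This makes the notion stable under
  splitting nodes.\<close>

definition settled :: "nat \<Rightarrow> nat list set \<Rightarrow> nat \<Rightarrow> bool" where
  "settled l F D \<longleftrightarrow> (\<exists>N. \<forall>T. ext (Suc k) F D T \<longrightarrow> (\<forall>i\<ge>N. l \<le> h T i))"

lemma settled_refines: "settled l F D \<Longrightarrow> refines F D F' D' \<Longrightarrow> settled l F' D'"
  unfolding settled_def using ext_refines by blast

text \<open>Each unsettled stage has a completion with another late \<open>l\<close>. By continuity
  a finite part of it fixes this occurrence; pruning that part to one path per live node restores
  the node count, so the step can be iterated to a limit tree.\<close>

lemma force_infinitely:
  assumes F: "binary_tree F" and nonempty: "1 \<le> card (level F D)"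
    and small: "card (level F D) \<le> Suc k"
    and settled: "settled l F D"
    and unsettled: "\<And>F' D'. binary_tree F' \<Longrightarrow> card (level F' D') = card (level F D)
      \<Longrightarrow> \<not> settled (Suc l) F' D'"
  obtains T where "ext (Suc k) F D T" "card (paths T) = card (level F D)"
    "infinite {i. h T i = l}"
proof -
  obtain N where N: "\<And>T i. ext (Suc k) F D T \<Longrightarrow> N \<le> i \<Longrightarrow> l \<le> h T i"
    using settled by (auto simp: settled_def)
  let ?P = "\<lambda>S. binary_tree (fst S) \<and> refines F D (fst S) (snd S)
    \<and> card (level (fst S) (snd S)) = card (level F D)"
  let ?Q = "\<lambda>n S S'. snd S < snd S' \<and> refines (fst S) (snd S) (fst S') (snd S')
    \<and> (\<forall>T. ext (Suc k) (fst S') (snd S') T \<longrightarrow> (\<exists>m\<ge>n. h T m = l))"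
  have "\<exists>S. \<forall>n. ?P (S n) \<and> ?Q n (S n) (S (Suc n))"
  proof (rule dependent_nat_choice)
    show "\<exists>S. ?P S" using F refines_refl by (intro exI[of _ "(F, D)"]) simp
    fix S n assume S: "?P S"
    obtain F' D' where FD: "S = (F', D')" by (cases S)
    have P: "binary_tree F'" "refines F D F' D'" "card (level F' D') = card (level F D)"
      using S by (simp_all add: FD)
    \<comment> \<open>Being beyond \<open>N\<close> makes the symbol exactly \<open>l\<close>; being
      beyond \<open>n\<close> makes the forced positions unbounded.\<close>
    obtain T m where T: "ext (Suc k) F' D' T" and m: "max n N \<le> m" "h T m < Suc l"
      using unsettled[OF P(1,3)] unfolding settled_def by (meson not_le)
    have hm: "h T m = l" using N[OF ext_refines[OF P(2) T], of m] m by simp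
    have val: "valid (Suc k) T" using T by (simp add: ext_def)
    obtain C where C: "\<And>T'. valid (Suc k) T' \<Longrightarrow> agree C T T' \<Longrightarrow> h T' m = h T m"
      using h_cont[OF val, of "Suc m"] by blast
    define E where "E = max C D'"
    \<comment> \<open>One path of \<open>T\<close> is chosen through each live node;
      \<open>T\<close> itself may have more.\<close>
    obtain X where X: "X \<subseteq> paths T" "inj_on (pre D') X" "level F' D' = pre D' ` X"
      using T unfolding ext_def subset_image_inj by blast
    have bt: "binary_tree T" using val by (simp add: valid_def)
    define T' where "T' = graft T E (pre (Suc E) ` X)"
    note pr = prune[OF bt X(1), where E = E, folded T'_def]
    have D': "D' \<le> E" by (simp add: E_def)
    have ref: "refines F' D' T' (Suc E)"
      using T X(3) D' by (intro pr(4)) (auto simp: ext_def)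
    have "card (level T' (Suc E)) = card (level F' D')"
      using inj_on_pre_mono[OF X(2), of "Suc E"] D' by (simp add: pr(3) X(2,3) card_image)
    moreover have "\<exists>m\<ge>n. h T'' m = l" if T'': "ext (Suc k) T' (Suc E) T''" for T''
    proof -
      have "agree E T T''" using T'' agree_trans[OF pr(2), of "Suc E" T''] by (simp add: ext_def)
      then have "agree C T T''" by (rule agree_mono) (simp add: E_def)
      then have "h T'' m = l" using C T'' hm by (simp add: ext_def)
      then show ?thesis using m(1) by auto
    qed
    ultimately show "\<exists>S'. ?P S' \<and> ?Q n S S'"
      using pr(1) ref refines_trans[OF P(2) ref] P(3) D' FD
      by (intro exI[of _ "(T', Suc E)"]) simp
  qed
  then obtain S where S: "\<And>n. ?P (S n)" "\<And>n. ?Q n (S n) (S (Suc n))" by blast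
  obtain T where T: "binary_tree T" "\<And>i. agree (snd (S i)) (fst (S i)) T"
    "\<And>i. bij_betw (pre (snd (S i))) (paths T) (level (fst (S i)) (snd (S i)))"
    by (rule limit_tree[of "\<lambda>i. fst (S i)" "\<lambda>i. snd (S i)" "card (level F D)"]) (use S in auto)
  have ext: "ext (Suc k) (fst (S i)) (snd (S i)) T" for i
    using S(1)[of i] nonempty small by (intro ext_bij[OF T] finite_level) simp_all
  show thesis
  proof
    show "ext (Suc k) F D T" using S(1)[of 0] ext[of 0] ext_refines by blast
    show "card (paths T) = card (level F D)"
      using bij_betw_same_card[OF T(3)[of 0]] S(1)[of 0] by simp
    show "infinite {i. h T i = l}"
      unfolding infinite_nat_iff_unbounded_le using S(2) ext by blast
  qed
qed

text \<open>Below \<open>l\<close> nothing is added to the instance after depth \<open>E\<close>, and enough symbols \<open>l\<close> have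
  been produced by then: the part of the sorted sequence read by \<open>g\<close> can no longer change.\<close>

lemma commit:
  assumes settled: "settled l F D" and T: "ext (Suc k) F D T" and inf: "infinite {i. h T i = l}"
  obtains E where "D \<le> E" "n \<le> E"
    "\<And>T'. ext (Suc k) F D T' \<Longrightarrow> agree E T T' \<Longrightarrow> pre n (g T') = pre n (g T)"
proof -
  obtain N where N: "\<And>T i. ext (Suc k) F D T \<Longrightarrow> N \<le> i \<Longrightarrow> l \<le> h T i"
    using settled by (auto simp: settled_def)
  have val: "valid (Suc k) T" using T by (simp add: ext_def)
  obtain A M where A: "\<forall>T'. valid (Suc k) T' \<and> agree A T T' \<and>
      (\<forall>i<M. sort_seq (h T) i = sort_seq (h T') i) \<longrightarrow> pre n (g T') = pre n (g T)"
    using g_cont[OF val, of n] by (elim exE)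
  \<comment> \<open>As many occurrences of \<open>l\<close> as \<open>g\<close> reads symbols of the
    sorted sequence; once \<open>h\<close> is fixed up to \<open>L\<close>, they are all
    present.\<close>
  obtain B where B: "finite B" "card B = M" "B \<subseteq> {i. h T i = l}"
    using infinite_arbitrarily_large[OF inf] by blast
  obtain b where b: "\<forall>i\<in>B. i < b" using B(1) finite_nat_set_iff_bounded by blast
  define L where "L = max N b"
  have "B \<subseteq> {i. i < L \<and> h T i = l}" using B(3) b by (auto simp: L_def)
  then have M: "M \<le> card {i. i < L \<and> h T i = l}"
    unfolding B(2)[symmetric] by (rule card_mono[rotated]) simp
  obtain C where C: "\<forall>T'. valid (Suc k) T' \<and> agree C T T' \<longrightarrow> (\<forall>i<L. h T' i = h T i)"
    using h_cont[OF val, of L] ..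
  show thesis
  proof (rule that[of "max (max A C) (max D n)"])
    fix T' assume T': "ext (Suc k) F D T'" and ag: "agree (max (max A C) (max D n)) T T'"
    have val': "valid (Suc k) T'" using T' by (simp add: ext_def)
    have "agree A T T'" "agree C T T'" using ag by (auto intro: agree_mono)
    have "sort_seq (h T) i = sort_seq (h T') i" if "i < M" for i
    proof (rule sort_seq_agree[OF _ _ _ inf M h_seqs[OF val'] that])
      show "h T i = h T' i" if "i < L" for i using C val' \<open>agree C T T'\<close> that by simp
    qed (use N[OF T] N[OF T'] in \<open>simp_all add: L_def\<close>)
    then show "pre n (g T') = pre n (g T)" using A val' \<open>agree A T T'\<close> by simp
  qed simp_all
qed

text \<open>If no such stage exists, \<open>l\<close> can be forced infinitely often with
  \<open>Suc l\<close> and with \<open>Suc (Suc l)\<close> live nodes. The second tree has two paths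
  through the node of \<open>F\<close> to which the first solution commits, so the path chosen next
  can be removed without harm to \<open>F\<close>, although the solution is already bound to
  it.\<close>

lemma settle_next:
  assumes F: "binary_tree F" and card: "card (level F D) = Suc l" and settled: "settled l F D"
    and "l < k"
  shows "\<exists>F' D'. binary_tree F' \<and> card (level F' D') = Suc (Suc l) \<and> settled (Suc l) F' D'"
proof (rule ccontr)
  assume "\<not> ?thesis"
  then have unsettled: "\<not> settled (Suc l) F' D'"
    if "binary_tree F'" "card (level F' D') = Suc (Suc l)" for F' D'
    using that by blast
  \<comment> \<open>Splitting a node of a settled stage would give a settled stage with one more
    live node.\<close>
  have unsettled': "\<not> settled (Suc l) F' D'"
    if F': "binary_tree F'" and card': "card (level F' D') = Suc l" for F' D'
  proof
    assume *: "settled (Suc l) F' D'"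
    obtain u where "u \<in> level F' D'" using card' by fastforce
    then obtain F'' where "binary_tree F''" "refines F' D' F'' (Suc D')"
        "card (level F'' (Suc D')) = Suc (Suc l)"
      using split_node[OF F'] card' by metis
    then show False using unsettled settled_refines[OF *] by blast
  qed
  obtain T where T: "ext (Suc k) F D T" "card (paths T) = card (level F D)"
      "infinite {i. h T i = l}"
    using force_infinitely[OF F _ _ settled] card unsettled' \<open>l < k\<close> by auto
  have val: "valid (Suc k) T" and bt: "binary_tree T" and ag: "agree D F T"
    using T(1) by (auto simp: ext_def valid_def)
  have injT: "inj_on (pre D) (paths T)" using inj_on_pre_paths[OF T(1,2)] .
  obtain E where E: "D \<le> E"
    "\<And>T'. ext (Suc k) F D T' \<Longrightarrow> agree E T T' \<Longrightarrow> pre D (g T') = pre D (g T)"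
    using commit[OF settled T(1,3), of D] by metis
  define y where "y = g T"
  \<comment> \<open>The split takes place beyond depth \<open>E\<close>, so the commitment made by
    \<open>T\<close> remains in force.\<close>
  define F1 where "F1 = graft T E (pre (Suc E) ` paths T)"
  note F1 = prune[OF bt order_refl, where E = E, folded F1_def]
  have ref1: "refines F D F1 (Suc E)"
    using F1(4)[OF E(1) ag] ext_level[OF T(1)] by simp
  define u where "u = pre (Suc E) y"
  have "u \<in> level F1 (Suc E)" using g_path[OF val] by (simp add: F1(3) u_def y_def)
  then obtain F2 where F2: "binary_tree F2" "refines F1 (Suc E) F2 (Suc (Suc E))"
      "card (level F2 (Suc (Suc E))) = Suc (card (level F1 (Suc E)))"
      "u @ [0] \<in> level F2 (Suc (Suc E))" "u @ [1] \<in> level F2 (Suc (Suc E))"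
    by (rule split_node[OF F1(1)])
  have "card (level F1 (Suc E)) = Suc l"
    using inj_on_pre_mono[OF injT, of "Suc E"] E(1) T(2) card by (simp add: F1(3) card_image)
  then have card2: "card (level F2 (Suc (Suc E))) = Suc (Suc l)" using F2(3) by simp
  have ref2: "refines F D F2 (Suc (Suc E))" using refines_trans[OF ref1 F2(2)] .
  \<comment> \<open>The extra live node is affordable: \<open>l < k\<close> keeps the count within
    \<open>Suc k\<close>.\<close>
  obtain T' where T': "ext (Suc k) F2 (Suc (Suc E)) T'"
      "card (paths T') = card (level F2 (Suc (Suc E)))" "infinite {i. h T' i = l}"
    using force_infinitely[OF F2(1) _ _ settled_refines[OF settled ref2]] card2 unsettled \<open>l < k\<close>
    by auto
  have T'F: "ext (Suc k) F D T'" using ext_refines[OF ref2 T'(1)] .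
  have val': "valid (Suc k) T'" and bt': "binary_tree T'" and ag': "agree (Suc (Suc E)) F2 T'"
    using T'(1) by (auto simp: ext_def valid_def)
  have injT': "inj_on (pre (Suc (Suc E))) (paths T')" using inj_on_pre_paths[OF T'(1,2)] .
  define z where "z = g T'"
  have z: "z \<in> paths T'" using g_path[OF val'] by (simp add: z_def)
  have "agree E T T'"
    using agree_trans[OF agree_trans[OF F1(2), of "Suc E" F2] ag'] F2(2) by (simp add: refines_def)
  then have zy: "pre D z = pre D y" using E(2)[OF T'F] by (simp add: z_def y_def)
  obtain E' where E': "D \<le> E'" "Suc (Suc E) \<le> E'"
    "\<And>T''. ext (Suc k) F D T'' \<Longrightarrow> agree E' T' T'' \<Longrightarrow>
       pre (Suc (Suc E)) (g T'') = pre (Suc (Suc E)) z"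
    using commit[OF settled T'F T'(3), of "Suc (Suc E)"] unfolding z_def by metis
  define X where "X = paths T' - {z}"
  have X: "X \<subseteq> paths T'" by (auto simp: X_def)
  define F3 where "F3 = graft T' E' (pre (Suc E') ` X)"
  note F3 = prune[OF bt' X, where E = E', folded F3_def]
  txt \<open>Both halves of \<open>u\<close> carry a path, so removing \<open>z\<close> leaves a path through every node of \<open>F\<close>.\<close>
  have "v \<in> pre D ` X" if v: "v \<in> level F D" for v
  proof -
    obtain x where x: "x \<in> paths T'" "pre D x = v"
      using v T'F unfolding ext_def by blast
    have "u @ [0] \<in> pre (Suc (Suc E)) ` paths T'" "u @ [1] \<in> pre (Suc (Suc E)) ` paths T'"
      using F2(4,5) ext_level[OF T'(1)] by simp_all
    then obtain x0 x1 where x01: "x0 \<in> paths T'" "u @ [0] = pre (Suc (Suc E)) x0"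
      "x1 \<in> paths T'" "u @ [1] = pre (Suc (Suc E)) x1"
      by (elim imageE)
    have "u @ [0] \<noteq> u @ [1]" by simp
    then have "x0 \<noteq> x1" using x01(2,4) by metis
    have "pre D x' = pre D y" if "u @ [b] = pre (Suc (Suc E)) x'" for b x'
      using arg_cong[OF that, of "take D"] E(1) by (simp add: u_def)
    then have "pre D x0 = pre D z" "pre D x1 = pre D z" using x01(2,4) zy by simp_all
    moreover have "x0 \<in> X \<or> x1 \<in> X" using x01(1,3) \<open>x0 \<noteq> x1\<close> by (auto simp: X_def)
    moreover have "x \<in> X \<or> x = z" using x(1) by (simp add: X_def)
    ultimately show ?thesis using x(2) by (metis imageI)
  qed
  then have "level F D \<subseteq> pre D ` X" by blast
  then have ref3: "refines F D F3 (Suc E')"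
    using F3(4)[OF E'(1)] T'F by (simp add: ext_def)
  have "finite (paths T')" "card (paths T') = Suc (Suc l)"
    using val' T'(2) card2 by (auto simp: valid_def)
  then have "card X = Suc l" using z by (simp add: X_def)
  moreover have "inj_on (pre (Suc E')) X"
    using inj_on_pre_mono[OF injT', of "Suc E'"] E'(2) X by (auto intro: inj_on_subset)
  ultimately have card3: "card (level F3 (Suc E')) = Suc l" by (simp add: F3(3) card_image)
  \<comment> \<open>Any completion of \<open>F3\<close> would do: its solution must begin like
    \<open>z\<close>, yet its paths begin like members of \<open>X\<close>, and \<open>z\<close> is
    separated from these at depth \<open>Suc (Suc E)\<close>.\<close>
  define T'' where "T'' = fill F3 (Suc E')"
  have T'': "ext (Suc k) F3 (Suc E') T''"
    unfolding T''_def using card3 \<open>l < k\<close> by (intro ext_fill F3(1)) simp_all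
  have "agree E' T' T''"
    using agree_trans[OF F3(2), of "Suc E'" T''] T'' by (simp add: ext_def)
  then have gz: "pre (Suc (Suc E)) (g T'') = pre (Suc (Suc E)) z"
    using E'(3) ext_refines[OF ref3 T''] by blast
  have "g T'' \<in> paths T''" using g_path T'' by (simp add: ext_def)
  then have "pre (Suc E') (g T'') \<in> pre (Suc E') ` X"
    using ext_level[OF T''] F3(3) by blast
  then obtain x where x: "x \<in> X" "pre (Suc E') (g T'') = pre (Suc E') x" by blast
  then have "pre (Suc (Suc E)) x = pre (Suc (Suc E)) z"
    using gz pre_eq_mono[OF x(2), of "Suc (Suc E)"] E'(2) by simp
  then show False using inj_onD[OF injT' _ _ z] x(1) by (auto simp: X_def)
qed

text \<open>The root is trivially settled for 0, and \<open>k\<close> steps use up all symbols while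
  staying within the allowed \<open>Suc k\<close> paths.\<close>

lemma contradiction: False
proof -
  have "\<exists>F D. binary_tree F \<and> card (level F D) = Suc l \<and> settled l F D" if "l \<le> k" for l
    using that
  proof (induction l)
    case 0
    have "binary_tree {[]}" by (simp add: binary_tree_def)
    moreover have "level {[]} 0 = {[]}" by (auto simp: level_def)
    ultimately show ?case by (intro exI[of _ "{[]}"] exI[of _ 0]) (simp add: settled_def)
  next
    case (Suc l)
    then show ?case using settle_next by (meson Suc_leD Suc_le_lessD)
  qed
  then obtain F D where F: "binary_tree F" "card (level F D) = Suc k" "settled k F D" by blast
  \<comment> \<open>An actual completion is required here, since \<open>settled\<close> would hold
    vacuously without one.\<close>
  have ext: "ext (Suc k) F D (fill F D)" using F by (intro ext_fill) simp_all
  obtain N where "k \<le> h (fill F D) N" using F(3) ext by (auto simp: settled_def)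
  moreover have "h (fill F D) N < k"
    using h_seqs ext by (auto simp: ext_def seqs_def)
  ultimately show False by simp
qed

end

section \<open>The reduction\<close>

definition tree_name :: "nat list set \<Rightarrow> baire" where
  "tree_name T n = (if list_decode n \<in> T then 1 else 0)"

lemma closed_space_tree_name:
  assumes "binary_tree T"
  shows "closed_space (tree_name T) = Some (paths T)"
proof -
  have "named_tree (tree_name T) = T" by (auto simp: named_tree_def tree_name_def)
  moreover have "tree_name T \<in> seqs 2" by (auto simp: tree_name_def seqs_def)
  ultimately show ?thesis using assms by (simp add: closed_space_def)
qed

text \<open>The finitely many codes below \<open>n\<close> decode to words of bounded length. This
  turns moduli for names into depths of trees.\<close>

lemma tree_name_agree: "\<exists>D. \<forall>T'. agree D T T' \<longrightarrow> (\<forall>i<n. tree_name T' i = tree_name T i)"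
proof -
  have "\<exists>D. \<forall>i<n. length (list_decode i) \<le> D"
    by (rule uniform_bound) (meson le_trans order_refl)+
  then obtain D where "\<forall>i<n. length (list_decode i) \<le> D" ..
  then have "\<forall>T'. agree D T T' \<longrightarrow> (\<forall>i<n. tree_name T' i = tree_name T i)"
    by (simp add: agree_def tree_name_def)
  then show ?thesis ..
qed

theorem theorem20:
  fixes k :: nat
  assumes "k \<ge> 1"
  shows "\<not> (choice_card_le (k + 1) \<le>\<^sub>W Sort k)"
proof
  assume "choice_card_le (k + 1) \<le>\<^sub>W Sort k"
  then obtain H K where H: "computable H" and K: "computable K" and
    red: "\<forall>G. realizer G (Sort k) \<longrightarrow>
      realizer (\<lambda>p. Option.bind (H p) (\<lambda>q. Option.bind (G q) (\<lambda>r. K (pair p r))))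
        (choice_card_le (k + 1))"
    unfolding weihrauch_le_def by (elim exE conjE)
  define G where "G q = (if q \<in> seqs k then Some (sort_seq q) else None)" for q
  have "realizer G (Sort k)"
    by (auto simp: realizer_def Sort_def seq_space_def G_def sort_seq_in_seqs split: if_splits)
  note red = red[rule_format, OF this]
  have sol: "\<exists>q r. H (tree_name T) = Some q \<and> q \<in> seqs k \<and>
      K (pair (tree_name T) (sort_seq q)) = Some r \<and> r \<in> paths T" if T: "valid (Suc k) T" for T
  proof -
    have name: "closed_space (tree_name T) = Some (paths T)"
      using T by (intro closed_space_tree_name) (simp add: valid_def)
    then have "solutions (choice_card_le (k + 1)) (paths T) = paths T"
      using T by (auto simp: choice_card_le_def restrict_problem_def closed_choice_def valid_def ran_def)
    moreover have "paths T \<noteq> {}" using T by (auto simp: valid_def)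
    moreover have "source (choice_card_le (k + 1)) = closed_space"
      "target (choice_card_le (k + 1)) = seq_space 2"
      by (simp_all add: choice_card_le_def restrict_problem_def closed_choice_def)
    ultimately have "\<exists>q y. Option.bind (H (tree_name T))
          (\<lambda>q. Option.bind (G q) (\<lambda>r. K (pair (tree_name T) r))) = Some q
        \<and> seq_space 2 q = Some y \<and> y \<in> paths T"
      using red[unfolded realizer_def, rule_format, of "tree_name T" "paths T"] name by simp
    then show ?thesis
      by (auto simp: bind_eq_Some_conv G_def seq_space_def split: if_splits)
  qed
  \<comment> \<open>On valid trees \<open>sol\<close> guarantees values, so \<open>the\<close> is
    proper there; elsewhere \<open>h\<close> and \<open>g\<close> are arbitrary.\<close>
  define h where "h T = the (H (tree_name T))" for T
  define g where "g T = the (K (pair (tree_name T) (sort_seq (h T))))" for T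
  have HK: "H (tree_name T) = Some (h T)" "h T \<in> seqs k"
    "K (pair (tree_name T) (sort_seq (h T))) = Some (g T)" "g T \<in> paths T"
    if "valid (Suc k) T" for T
    using sol[OF that] by (auto simp: h_def g_def)
  interpret sort_reduction k h g
  proof
    fix T n assume T: "valid (Suc k) T"
    show "h T \<in> seqs k" "g T \<in> paths T" using HK[OF T] by blast+
    obtain N where N: "\<forall>p' q'. H p' = Some q' \<and> (\<forall>i<N. p' i = tree_name T i) \<longrightarrow>
        (\<forall>i<n. q' i = h T i)"
      using computable_continuous[OF H HK(1)[OF T], of n] ..
    obtain D where D: "\<forall>T'. agree D T T' \<longrightarrow> (\<forall>i<N. tree_name T' i = tree_name T i)"
      using tree_name_agree[of T N] ..
    have "\<forall>i<n. h T' i = h T i" if "valid (Suc k) T'" "agree D T T'" for T'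
    proof -
      have "\<forall>i<N. tree_name T' i = tree_name T i" using D that(2) by simp
      with HK(1)[OF that(1)] show ?thesis using N by simp
    qed
    then show "\<exists>D. \<forall>T'. valid (Suc k) T' \<and> agree D T T' \<longrightarrow> (\<forall>i<n. h T' i = h T i)" by blast
    define P where "P T = pair (tree_name T) (sort_seq (h T))" for T
    have KP: "K (P T) = Some (g T)" if "valid (Suc k) T" for T
      using HK(3)[OF that] by (simp add: P_def)
    obtain M where M: "\<forall>p' q'. K p' = Some q' \<and> (\<forall>i<M. p' i = P T i) \<longrightarrow>
        (\<forall>i<n. q' i = g T i)"
      using computable_continuous[OF K KP[OF T], of n] ..
    obtain E where E: "\<forall>T'. agree E T T' \<longrightarrow> (\<forall>i<M. tree_name T' i = tree_name T i)"
      using tree_name_agree[of T M] ..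
    have "pre n (g T') = pre n (g T)" if T': "valid (Suc k) T'" "agree E T T'"
      "\<forall>i<M. sort_seq (h T) i = sort_seq (h T') i" for T'
    proof -
      have "tree_name T' i = tree_name T i" if "i < M" for i using E T'(2) that by simp
      \<comment> \<open>Position \<open>i\<close> of a pair reads position \<open>i div 2\<close> of
        a component, so the same bound \<open>M\<close> suffices for both.\<close>
      then have "\<forall>i<M. P T' i = P T i" using T'(3) by (simp add: P_def pair_def)
      then show ?thesis
        using M KP[OF T'(1)] by (simp add: pre_eq_iff)
    qed
    then show "\<exists>D N. \<forall>T'. valid (Suc k) T' \<and> agree D T T' \<and>
        (\<forall>i<N. sort_seq (h T) i = sort_seq (h T') i) \<longrightarrow> pre n (g T') = pre n (g T)" by blast
  qed
  show False by (rule contradiction)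
qed

end
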